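(* Let $k\ge 1$, and let $G=(V,E)$ be a finite simple graph with $|V|\ge k$. Then \[ \sum_{i=1}^k \lambda_i(L(G))\le |E|+k^2. \]
   Context: $L(G)\in\mathbb{R}^{|V|\times|V|}$ is the Laplacian matrix of $G$: $L(G)_{u,u}=\deg_G(u)$, $L(G)_{u,v}=-1$ if $\{u,v\}\in E$, and $0$ otherwise. For a symmetric real matrix $M$, $\lambda_i(M)$ is its $i$-th largest eigenvalue (with multiplicity). *)

theory Defs
  imports "HOL-Analysis.Analysis"
begin

text \<open>A finite simple graph is given by its edge set; its vertex set is the whole finite
  type \<^typ>\<open>'v\<close>, so that matrices with rows and columns indexed by the vertices have type
  \<^typ>\<open>real^'v^'v\<close>.\<close>

definition simple_graph :: "'v::finite set set \<Rightarrow> bool" where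
  "simple_graph E \<longleftrightarrow> (\<forall>e\<in>E. card e = 2)"

definition degree :: "'v::finite set set \<Rightarrow> 'v \<Rightarrow> nat" where
  "degree E u = card {e \<in> E. u \<in> e}"

definition laplacian :: "'v::finite set set \<Rightarrow> real^'v^'v" where
  "laplacian E = (\<chi> u v. if u = v then real (degree E u) else if {u, v} \<in> E then - 1 else 0)"

definition eigenspace :: "real^'n^'n \<Rightarrow> real \<Rightarrow> (real^'n) set" where
  "eigenspace M c = {x. M *v x = c *\<^sub>R x}"

definition eigenvalues :: "real^'n^'n \<Rightarrow> real set" where
  "eigenvalues M = {c. \<exists>x. x \<noteq> 0 \<and> M *v x = c *\<^sub>R x}"

text \<open>The eigenvalues in decreasing order, each repeated according to the dimension of its
  eigenspace. For a symmetric real matrix, where geometric and algebraic multiplicities agree,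
  this list has exactly \<open>CARD('n)\<close> entries. The set of eigenvalues is always finite, so
  \<^const>\<open>sorted_list_of_set\<close> lists all of them.\<close>

definition eigenvalue_list :: "real^'n^'n \<Rightarrow> real list" where
  "eigenvalue_list M =
     concat (map (\<lambda>c. replicate (dim (eigenspace M c)) c)
       (rev (sorted_list_of_set (eigenvalues M))))"

text \<open>The \<open>i\<close>-th largest eigenvalue, counted from \<open>i = 1\<close>; meaningful for symmetric \<open>M\<close> and
  \<open>1 \<le> i \<le> CARD('n)\<close>.\<close>

definition eigval :: "nat \<Rightarrow> real^'n^'n \<Rightarrow> real" where
  "eigval i M = eigenvalue_list M ! (i - 1)"

end

theory Submission
  imports Defs
begin

text \<open>Let \<open>S\<close> be an orthonormal family of \<open>k\<close> eigenvectors for the largest eigenvalues, let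
  \<open>P = \<Sum>x\<in>S. x x\<^sup>T\<close>, and write \<open>a u = P u u\<close>; then \<open>P\<close> is a projection, so
  \<open>\<Sum>v. (P u v)\<^sup>2 = a u\<close> and \<open>\<Sum>u. a u = k\<close>. The eigenvalue sum minus \<open>|E|\<close> is the sum over the
  edges \<open>uv\<close> of the excess \<open>a u + a v - 1 - 2 * P u v\<close>. By Young's inequality
  \[ -2 P_{uv} \le \frac{P_{uv}^2}{1 - a_u} + \frac{P_{uv}^2}{1 - a_v}
     + \frac{(1 - a_u)(1 - a_v)}{2 - a_u - a_v}. \]
  The first two terms sum to at most \<open>k\<close>, because \<open>\<Sum>v\<noteq>u. (P u v)\<^sup>2 = a u * (1 - a u)\<close>. The last
  one, together with \<open>a u + a v - 1\<close>, is at most \<open>9/8 * a u * a v\<close>, and at most \<open>a u * a v\<close> if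
  \<open>a u + a v \<le> 1\<close>. This gives \<open>9/16 * k\<^sup>2 + k\<close>, which suffices for \<open>k \<ge> 3\<close>; for \<open>k = 2\<close>
  either the sharper constant applies to all pairs, or \<open>\<Sum>u. (a u)\<^sup>2 \<ge> 1/2\<close>, and these diagonal
  terms are missing from the sum over pairs. For \<open>k = 1\<close> the edges of positive
  excess pairwise intersect and contain no triangle, so they form a star.\<close>

section \<open>Spectral theorem for symmetric real matrices\<close>

lemma symmetric_matrix_inner:
  fixes M :: "real^'n^'n"
  assumes "transpose M = M"
  shows "x \<bullet> (M *v y) = (M *v x) \<bullet> y"
  by (metis assms dot_lmul_matrix transpose_matrix_vector)

text \<open>A maximiser \<open>u\<close> of the quadratic form on the unit sphere of
  \<open>S\<close> works: varying \<open>u\<close> in a direction of \<open>S\<close> orthogonal to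
  it shows that \<open>M *v u\<close> has no component in that direction.\<close>

lemma symmetric_matrix_eigenvector_in_subspace:
  fixes M :: "real^'n^'n"
  assumes sym: "transpose M = M" and S: "subspace S" "S \<noteq> {0}"
    and inv: "\<And>x. x \<in> S \<Longrightarrow> M *v x \<in> S"
  obtains u c where "u \<in> S" "u \<noteq> 0" "M *v u = c *\<^sub>R u"
proof -
  define K where "K = S \<inter> sphere 0 1"
  obtain w where w: "w \<in> S" "w \<noteq> 0" using S subspace_0 by blast
  have "(1 / norm w) *\<^sub>R w \<in> K" using w S by (simp add: K_def subspace_scale)
  moreover have "compact K" unfolding K_def
    by (simp add: closed_Int_compact closed_subspace S)
  moreover have "continuous_on K (\<lambda>x. x \<bullet> (M *v x))"
    by (intro continuous_intros matrix_vector_mult_linear_continuous_on)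
  ultimately obtain u where u: "u \<in> K" and max: "\<And>y. y \<in> K \<Longrightarrow> y \<bullet> (M *v y) \<le> u \<bullet> (M *v u)"
    using continuous_attains_sup by (metis empty_iff)
  define c where "c = u \<bullet> (M *v u)"
  have uS: "u \<in> S" and u1: "u \<bullet> u = 1" using u by (auto simp: K_def norm_eq_1)
  have bound: "y \<bullet> (M *v y) \<le> c * (y \<bullet> y)" if "y \<in> S" for y
  proof (cases "y = 0")
    case False
    have "(1 / norm y) *\<^sub>R y \<in> K" using that False S by (simp add: K_def subspace_scale)
    from max[OF this] False show ?thesis
      by (simp add: c_def matrix_vector_mult_scaleR field_simps dot_square_norm power2_eq_square)
  qed simp
  have orth: "y \<bullet> (M *v u) = 0" if y: "y \<in> S" "y \<bullet> u = 0" for y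
  proof (rule ccontr)
    assume nz: "y \<bullet> (M *v u) \<noteq> 0"
    define b q where "b = y \<bullet> (M *v u)" and "q = c * (y \<bullet> y) - y \<bullet> (M *v y)"
    \<comment> \<open>Maximality at \<open>u + t *\<^sub>R y\<close>: a nonzero linear term in
      \<open>t\<close> would win against the quadratic one for small \<open>t\<close>.\<close>
    have ineq: "2 * t * b \<le> t\<^sup>2 * q" for t
    proof -
      have "u + t *\<^sub>R y \<in> S" using y uS S by (simp add: subspace_add subspace_scale)
      from bound[OF this] show ?thesis
        using y symmetric_matrix_inner[OF sym, of u y] u1
        by (simp add: matrix_vector_right_distrib matrix_vector_mult_scaleR inner_add
            algebra_simps inner_commute b_def q_def c_def[symmetric] power2_eq_square)
    qed
    have q: "q \<ge> 0" using bound[OF y(1)] by (simp add: q_def)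
    \<comment> \<open>A step size small enough for the contradiction; \<open>q + 1\<close> replaces
      \<open>q\<close>, which may vanish.\<close>
    define r where "r = b / (q + 1)"
    have b: "b = r * (q + 1)" using q by (simp add: r_def)
    have "r\<^sup>2 * (q + 2) \<le> 0"
      using ineq[of r] by (simp add: b algebra_simps power2_eq_square)
    then have "r = 0" using q by (simp add: mult_le_0_iff)
    then show False using nz b by (simp add: b_def)
  qed
  define d where "d = M *v u - c *\<^sub>R u"
  have dS: "d \<in> S" using S uS inv by (simp add: d_def subspace_diff subspace_scale)
  have du: "d \<bullet> u = 0" using u1 by (simp add: d_def inner_diff c_def inner_commute)
  have "d \<bullet> d = d \<bullet> (M *v u) - c * (d \<bullet> u)" by (simp add: d_def inner_diff_right)
  then have "d = 0" using orth[OF dS du] du by simp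
  moreover have "u \<noteq> 0" using u1 by auto
  ultimately show thesis using that uS by (simp add: d_def)
qed

lemma subspace_eigenspace: "subspace (eigenspace M c)"
  by (auto simp: subspace_def eigenspace_def matrix_vector_right_distrib scaleR_add_right
      matrix_vector_mult_scaleR)

lemma eigenspaces_orthogonal:
  assumes "transpose M = M" "x \<in> eigenspace M c" "y \<in> eigenspace M d" "c \<noteq> d"
  shows "orthogonal x y"
  using symmetric_matrix_inner[OF assms(1), of x y] assms(2-)
  by (auto simp: eigenspace_def orthogonal_def)

text \<open>One eigenvector per eigenvalue gives an orthogonal, hence independent family. Finiteness
  matters because \<open>sorted_list_of_set\<close> is empty on infinite sets.\<close>

lemma finite_eigenvalues:
  fixes M :: "real^'n^'n"
  assumes sym: "transpose M = M"
  shows "finite (eigenvalues M)"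
proof -
  obtain f where f: "\<And>c. c \<in> eigenvalues M \<Longrightarrow> f c \<noteq> 0 \<and> f c \<in> eigenspace M c"
    using bchoice[of "eigenvalues M" "\<lambda>c x. x \<noteq> 0 \<and> x \<in> eigenspace M c"]
    by (auto simp: eigenvalues_def eigenspace_def)
  have "inj_on f (eigenvalues M)"
    using f eigenspaces_orthogonal[OF sym] by (metis inj_onI orthogonal_self)
  moreover have "independent (f ` eigenvalues M)"
    using f eigenspaces_orthogonal[OF sym]
    by (intro pairwise_orthogonal_independent) (auto simp: pairwise_def, metis)
  ultimately show ?thesis
    using finite_imageD independent_bound by blast
qed

text \<open>Orthonormal bases of the eigenspaces are concatenated in the order used by
  \<open>eigenvalue_list\<close>. They span: otherwise their orthogonal complement, being invariant
  under \<open>M\<close>, would contain another eigenvector. In particular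
  \<open>eigenvalue_list M\<close> has \<open>CARD('n)\<close> entries.\<close>

lemma eigenvector_list_exists:
  fixes M :: "real^'n^'n"
  assumes sym: "transpose M = M"
  obtains vs where "length vs = CARD('n)" "distinct vs" "pairwise orthogonal (set vs)"
    "\<And>x. x \<in> set vs \<Longrightarrow> norm x = 1"
    "list_all2 (\<lambda>x c. M *v x = c *\<^sub>R x) vs (eigenvalue_list M)"
proof -
  have "\<exists>xs. set xs \<subseteq> eigenspace M c \<and> pairwise orthogonal (set xs) \<and> (\<forall>x\<in>set xs. norm x = 1) \<and>
      length xs = dim (eigenspace M c) \<and> distinct xs \<and> span (set xs) = eigenspace M c" for c
  proof -
    obtain B where B: "B \<subseteq> eigenspace M c" "pairwise orthogonal B" "\<And>x. x \<in> B \<Longrightarrow> norm x = 1"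
      "independent B" "card B = dim (eigenspace M c)" "span B = eigenspace M c"
      using orthonormal_basis_subspace[OF subspace_eigenspace] by blast
    obtain xs where "set xs = B" "distinct xs"
      using finite_distinct_list independent_bound B(4) by blast
    then show ?thesis using B distinct_card by metis
  qed
  then obtain f where f: "\<And>c. set (f c) \<subseteq> eigenspace M c" "\<And>c. pairwise orthogonal (set (f c))"
    "\<And>c x. x \<in> set (f c) \<Longrightarrow> norm x = 1" "\<And>c. length (f c) = dim (eigenspace M c)"
    "\<And>c. distinct (f c)" "\<And>c. span (set (f c)) = eigenspace M c"
    by metis
  define cs where "cs = rev (sorted_list_of_set (eigenvalues M))"
  have cs: "distinct cs" "set cs = eigenvalues M"
    using finite_eigenvalues[OF sym] by (auto simp: cs_def)
  define vs where "vs = concat (map f cs)"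
  have set_vs: "set vs = (\<Union>c\<in>eigenvalues M. set (f c))" by (simp add: vs_def cs)
  have norm1: "norm x = 1" if "x \<in> set vs" for x using that f(3) by (auto simp: set_vs)
  have orth: "pairwise orthogonal (set vs)"
  proof (rule pairwiseI)
    fix x y assume "x \<in> set vs" "y \<in> set vs" "x \<noteq> y"
    then obtain c d where cd: "x \<in> set (f c)" "y \<in> set (f d)" by (auto simp: set_vs)
    show "orthogonal x y"
    proof (cases "c = d")
      case True
      then show ?thesis using cd f(2)[of c] \<open>x \<noteq> y\<close> by (auto simp: pairwise_def)
    next
      case False
      then show ?thesis using cd f(1) eigenspaces_orthogonal[OF sym] by blast
    qed
  qed
  have disj: "set (f c) \<inter> set (f d) = {}" if "c \<noteq> d" for c d
  proof (rule ccontr)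
    assume "set (f c) \<inter> set (f d) \<noteq> {}"
    then obtain x where x: "x \<in> set (f c)" "x \<in> set (f d)" by blast
    then have "orthogonal x x" using f(1) that eigenspaces_orthogonal[OF sym] by blast
    then show False using f(3)[OF x(1)] by (simp add: orthogonal_self)
  qed
  have dist: "distinct vs"
    unfolding vs_def using cs(1)
  proof (induction cs)
    case (Cons c cs)
    then have "set (f c) \<inter> set (f d) = {}" if "d \<in> set cs" for d
      using that by (intro disj) auto
    then have "set (f c) \<inter> set (concat (map f cs)) = {}" by auto
    with Cons f(5) show ?case by simp
  qed simp
  have indep: "independent (set vs)"
    using orth norm1 by (intro pairwise_orthogonal_independent) force+
  have span: "span (set vs) = UNIV"
  proof (rule ccontr)
    assume ne: "span (set vs) \<noteq> UNIV"
    define W where "W = {x. \<forall>y \<in> set vs. orthogonal y x}"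
    have W_sub: "subspace W"
      by (auto simp: W_def subspace_def orthogonal_def inner_add_right)
    have "span (set vs) \<subset> span UNIV" using ne by auto
    then obtain w where "w \<noteq> 0" "\<And>y. y \<in> span (set vs) \<Longrightarrow> orthogonal w y"
      using orthogonal_to_subspace_exists_gen by blast
    then have "W \<noteq> {0}"
      by (auto simp: W_def orthogonal_commute span_base)
    moreover have "M *v x \<in> W" if "x \<in> W" for x
    proof -
      have "y \<bullet> (M *v x) = 0" if y: "y \<in> set vs" for y
      proof -
        obtain c where "M *v y = c *\<^sub>R y" using y f(1) by (auto simp: set_vs eigenspace_def)
        then show ?thesis
          using symmetric_matrix_inner[OF sym, of y x] \<open>x \<in> W\<close> y
          by (auto simp: W_def orthogonal_def)
      qed
      then show ?thesis by (simp add: W_def orthogonal_def)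
    qed
    ultimately obtain u c where u: "u \<in> W" "u \<noteq> 0" "M *v u = c *\<^sub>R u"
      using symmetric_matrix_eigenvector_in_subspace[OF sym W_sub] by blast
    \<comment> \<open>The new eigenvector lies in an eigenspace already spanned by part of
      \<open>vs\<close>, so it is orthogonal to itself.\<close>
    then have "c \<in> eigenvalues M" "u \<in> eigenspace M c" by (auto simp: eigenvalues_def eigenspace_def)
    then have "u \<in> span (set vs)"
      using f(6)[of c] span_mono[of "set (f c)" "set vs"] set_vs by blast
    moreover have "orthogonal u y" if "y \<in> set vs" for y
      using u that by (auto simp: W_def orthogonal_commute)
    ultimately have "orthogonal u u" using orthogonal_to_span by blast
    then show False using u by (simp add: orthogonal_self)
  qed
  have "card (set vs) = DIM(real^'n)"
    using indep span by (metis dim_UNIV dim_span_eq_card_independent)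
  then have len: "length vs = CARD('n)" using dist by (simp add: distinct_card)
  have "list_all2 (\<lambda>x c. M *v x = c *\<^sub>R x) (f c) (replicate (dim (eigenspace M c)) c)" for c
    using f(1)[of c] by (auto simp: list_all2_conv_all_nth f(4) eigenspace_def subset_iff)
  then have "list_all2 (\<lambda>x c. M *v x = c *\<^sub>R x) vs (eigenvalue_list M)"
    unfolding vs_def eigenvalue_list_def cs_def[symmetric]
    by (induction cs) (auto intro: list_all2_appendI)
  then show thesis using that len dist orth norm1 by blast
qed

lemma sum_eigval_eq:
  fixes M :: "real^'n^'n"
  assumes sym: "transpose M = M" and k: "k \<le> CARD('n)"
  obtains S where "finite S" "card S = k" "pairwise orthogonal S" "\<And>x. x \<in> S \<Longrightarrow> norm x = 1"
    "(\<Sum>i=1..k. eigval i M) = (\<Sum>x\<in>S. x \<bullet> (M *v x))"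
proof -
  obtain vs where vs: "length vs = CARD('n)" "distinct vs" "pairwise orthogonal (set vs)"
    "\<And>x. x \<in> set vs \<Longrightarrow> norm x = 1"
    "list_all2 (\<lambda>x c. M *v x = c *\<^sub>R x) vs (eigenvalue_list M)"
    using eigenvector_list_exists[OF sym] by blast
  define S where "S = set (take k vs)"
  have sub: "S \<subseteq> set vs" by (simp add: S_def set_take_subset)
  \<comment> \<open>\<open>eigval\<close> counts from 1, lists count from 0.\<close>
  have "eigval (Suc i) M = (vs ! i) \<bullet> (M *v (vs ! i))" if "i < k" for i
  proof -
    have "M *v (vs ! i) = (eigenvalue_list M ! i) *\<^sub>R (vs ! i)" "norm (vs ! i) = 1"
      using vs k that by (auto simp: list_all2_conv_all_nth)
    then show ?thesis by (simp add: eigval_def dot_square_norm)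
  qed
  then have "(\<Sum>i=1..k. eigval i M) = (\<Sum>i<k. (vs ! i) \<bullet> (M *v (vs ! i)))"
    by (simp add: sum.atLeast1_atMost_eq)
  also have "\<dots> = (\<Sum>x\<in>S. x \<bullet> (M *v x))"
  proof (rule sum.reindex_bij_betw[of "(!) vs" "{..<k}" S "\<lambda>x. x \<bullet> (M *v x)"])
    show "bij_betw ((!) vs) {..<k} S"
      unfolding S_def by (rule bij_betwI') (use vs k in \<open>auto simp: nth_eq_iff_index_eq in_set_conv_nth\<close>)
  qed
  finally show thesis
    using that[of S] vs sub k
    by (auto simp: S_def distinct_card pairwise_subset)
qed

section \<open>Quadratic form of the Laplacian as a sum over edges\<close>

lemma degree_eq_card_neighbours:
  assumes "simple_graph E"
  shows "degree E u = card {v. {u, v} \<in> E}"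
proof -
  have "e \<in> (\<lambda>v. {u, v}) ` {v. {u, v} \<in> E}" if "e \<in> E" "u \<in> e" for e
  proof -
    have "card e = 2" using assms that by (simp add: simple_graph_def)
    then obtain a b where "e = {a, b}" unfolding card_2_iff by blast
    then have "e = {u, if a = u then b else a}" using that by auto
    then show ?thesis using that by blast
  qed
  then have "{e \<in> E. u \<in> e} = (\<lambda>v. {u, v}) ` {v. {u, v} \<in> E}" by auto
  moreover have "inj (\<lambda>v. {u, v})" by (auto intro!: injI simp: doubleton_eq_iff)
  ultimately show ?thesis
    by (simp add: degree_def card_image inj_on_subset)
qed

lemma sum_degrees:
  fixes E :: "'v::finite set set"
  assumes "simple_graph E"
  shows "(\<Sum>u\<in>UNIV. degree E u) = 2 * card E"
proof -
  have "(\<Sum>u\<in>UNIV. degree E u) = (\<Sum>u\<in>UNIV. \<Sum>e | e \<in> E \<and> u \<in> e. 1)"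
    by (simp add: degree_def)
  also have "\<dots> = (\<Sum>e\<in>E. \<Sum>u | u \<in> UNIV \<and> u \<in> e. 1)"
    by (rule sum.swap_restrict) auto
  also have "\<dots> = (\<Sum>e\<in>E. 2)"
    using assms by (intro sum.cong) (auto simp: simple_graph_def)
  finally show ?thesis by simp
qed

lemma sum_neighbours_swap:
  fixes f :: "'v::finite \<Rightarrow> 'v \<Rightarrow> 'a::comm_monoid_add"
  shows "(\<Sum>u\<in>UNIV. \<Sum>v | {u, v} \<in> E. f u v) = (\<Sum>u\<in>UNIV. \<Sum>v | {u, v} \<in> E. f v u)"
  using sum.swap_restrict[of UNIV UNIV f "\<lambda>u v. {u, v} \<in> E"] by (simp add: insert_commute)

text \<open>Edge sums run over ordered pairs here and below, so each edge counts twice; hence the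
  factor 2.\<close>

lemma laplacian_quadratic_form:
  fixes x :: "real^'v::finite"
  assumes E: "simple_graph E"
  shows "2 * (x \<bullet> (laplacian E *v x)) = (\<Sum>u\<in>UNIV. \<Sum>v | {u, v} \<in> E. (x $ u - x $ v)\<^sup>2)"
proof -
  have loop: "{u, u} \<notin> E" for u using E by (auto simp: simple_graph_def)
  have row: "(laplacian E *v x) $ u = real (degree E u) * x $ u - (\<Sum>v | {u, v} \<in> E. x $ v)" for u
  proof -
    have "(laplacian E *v x) $ u = (\<Sum>v\<in>UNIV. (if u = v then real (degree E u) * x $ v else 0)
        - (if {u, v} \<in> E then x $ v else 0))"
      unfolding matrix_vector_mult_def laplacian_def using loop
      by (auto intro!: sum.cong)
    also have "\<dots> = real (degree E u) * x $ u - (\<Sum>v | {u, v} \<in> E. x $ v)"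
      by (simp add: sum_subtractf sum.inter_filter[symmetric])
    finally show ?thesis .
  qed
  have "(\<Sum>u\<in>UNIV. \<Sum>v | {u, v} \<in> E. (x $ u - x $ v)\<^sup>2) =
      (\<Sum>u\<in>UNIV. \<Sum>v | {u, v} \<in> E. (x $ u)\<^sup>2) + (\<Sum>u\<in>UNIV. \<Sum>v | {u, v} \<in> E. (x $ v)\<^sup>2)
      - 2 * (\<Sum>u\<in>UNIV. \<Sum>v | {u, v} \<in> E. x $ u * x $ v)"
    by (simp add: power2_diff sum.distrib sum_subtractf sum_distrib_left mult.assoc)
  also have "(\<Sum>u\<in>UNIV. \<Sum>v | {u, v} \<in> E. (x $ v)\<^sup>2) = (\<Sum>u\<in>UNIV. \<Sum>v | {u, v} \<in> E. (x $ u)\<^sup>2)"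
    by (rule sum_neighbours_swap)
  also have "(\<Sum>u\<in>UNIV. \<Sum>v | {u, v} \<in> E. (x $ u)\<^sup>2) = (\<Sum>u\<in>UNIV. real (degree E u) * (x $ u)\<^sup>2)"
    by (simp add: degree_eq_card_neighbours[OF E])
  finally show ?thesis
    by (simp add: inner_vec_def row right_diff_distrib sum_subtractf sum_distrib_left
        power2_eq_square mult_ac)
qed

lemma transpose_laplacian: "transpose (laplacian E) = laplacian E"
  by (auto simp: transpose_def laplacian_def vec_eq_iff insert_commute)

text \<open>A 1 is split off from each ordered pair; these add up to the degree sum
  \<open>2 * card E\<close>. It remains to bound the sum of the excesses by twice
  \<open>k\<^sup>2\<close>.\<close>

lemma sum_laplacian_quadratic_forms:
  fixes S :: "(real^'v::finite) set"
  assumes E: "simple_graph E"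
  defines "P \<equiv> \<lambda>u v. \<Sum>x\<in>S. x $ u * x $ v"
  shows "2 * (\<Sum>x\<in>S. x \<bullet> (laplacian E *v x)) =
    2 * real (card E) + (\<Sum>u\<in>UNIV. \<Sum>v | {u, v} \<in> E. P u u + P v v - 1 - 2 * P u v)"
proof -
  have *: "(\<Sum>x\<in>S. (x $ u - x $ v)\<^sup>2) = P u u + P v v - 1 - 2 * P u v + 1" for u v
    unfolding power2_diff P_def
    by (simp add: sum.distrib sum_subtractf sum_distrib_left power2_eq_square mult.assoc)
  have "2 * (\<Sum>x\<in>S. x \<bullet> (laplacian E *v x)) =
      (\<Sum>x\<in>S. \<Sum>u\<in>UNIV. \<Sum>v | {u, v} \<in> E. (x $ u - x $ v)\<^sup>2)"
    by (simp add: sum_distrib_left laplacian_quadratic_form[OF E])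
  also have "\<dots> = (\<Sum>u\<in>UNIV. \<Sum>v | {u, v} \<in> E. \<Sum>x\<in>S. (x $ u - x $ v)\<^sup>2)"
    by (simp add: sum.swap[of _ _ S])
  also have "\<dots> = (\<Sum>u\<in>UNIV. \<Sum>v | {u, v} \<in> E. (P u u + P v v - 1 - 2 * P u v) + 1)"
    by (simp only: *)
  also have "\<dots> = (\<Sum>u\<in>UNIV. \<Sum>v | {u, v} \<in> E. P u u + P v v - 1 - 2 * P u v)
      + real (\<Sum>u\<in>UNIV. degree E u)"
    by (simp only: sum.distrib) (simp add: degree_eq_card_neighbours[OF E])
  finally show ?thesis using sum_degrees[OF E] by simp
qed

section \<open>The projection onto the span of an orthonormal family\<close>

text \<open>This is a diagonal entry of \<open>P P = P\<close> for the symmetric projection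
  \<open>P\<close>, expanded by orthonormality.\<close>

lemma orthonormal_gram_idempotent:
  fixes S :: "(real^'v::finite) set"
  assumes fin: "finite S" and orth: "pairwise orthogonal S" and norm: "\<And>x. x \<in> S \<Longrightarrow> norm x = 1"
  shows "(\<Sum>v\<in>UNIV. (\<Sum>x\<in>S. x $ u * x $ v)\<^sup>2) = (\<Sum>x\<in>S. x $ u * x $ u)"
proof -
  have ip: "(\<Sum>v\<in>UNIV. x $ v * y $ v) = (if y = x then 1 else 0)" if "x \<in> S" "y \<in> S" for x y
    using orth norm[OF that(1)] that
    by (auto simp: pairwise_def orthogonal_def inner_vec_def norm_eq_1)
  have "(\<Sum>v\<in>UNIV. (\<Sum>x\<in>S. x $ u * x $ v)\<^sup>2) =
      (\<Sum>v\<in>UNIV. \<Sum>x\<in>S. \<Sum>y\<in>S. x $ u * y $ u * (x $ v * y $ v))"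
    by (simp add: power2_eq_square sum_product mult_ac)
  also have "\<dots> = (\<Sum>x\<in>S. \<Sum>y\<in>S. x $ u * y $ u * (\<Sum>v\<in>UNIV. x $ v * y $ v))"
    by (simp add: sum.swap[of _ _ UNIV] sum_distrib_left)
  also have "\<dots> = (\<Sum>x\<in>S. \<Sum>y\<in>S. if y = x then x $ u * y $ u else 0)"
    by (intro sum.cong refl) (simp add: ip)
  finally show ?thesis using fin by simp
qed

lemma orthonormal_gram_trace:
  fixes S :: "(real^'v::finite) set"
  assumes "\<And>x. x \<in> S \<Longrightarrow> norm x = 1"
  shows "(\<Sum>u\<in>UNIV. \<Sum>x\<in>S. x $ u * x $ u) = real (card S)"
proof -
  have "(\<Sum>u\<in>UNIV. \<Sum>x\<in>S. x $ u * x $ u) = (\<Sum>x\<in>S. x \<bullet> x)"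
    by (subst sum.swap) (simp add: inner_vec_def)
  also have "\<dots> = (\<Sum>x\<in>S. 1)"
    using assms by (intro sum.cong) (auto simp: norm_eq_1)
  finally show ?thesis by simp
qed

section \<open>Scalar inequalities for a single edge\<close>

text \<open>With \<open>x = 1 - a\<close> and \<open>y = 1 - b\<close>, the quadratic
  \<open>p\<^sup>2 / x + p\<^sup>2 / y + 2 * p\<close> has minimum \<open>- x * y / (x + y)\<close>;
  completing the square shows it.\<close>

lemma edge_excess_young:
  fixes a b p :: real
  assumes "a < 1" "b < 1"
  shows "a + b - 1 - 2 * p \<le>
    a + b - 1 + (1 - a) * (1 - b) / (2 - a - b) + p\<^sup>2 / (1 - a) + p\<^sup>2 / (1 - b)"
proof -
  define x y where "x = 1 - a" and "y = 1 - b"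
  have pos: "x > 0" "y > 0" using assms by (auto simp: x_def y_def)
  have "x * y / (x + y) + p\<^sup>2 / x + p\<^sup>2 / y + 2 * p = (p * (x + y) + x * y)\<^sup>2 / (x * y * (x + y))"
    using pos by (simp add: divide_simps) (simp add: algebra_simps power2_eq_square)
  also have "\<dots> \<ge> 0" using pos by simp
  finally show ?thesis by (simp add: x_def y_def algebra_simps)
qed

lemma harmonic_bound_light_pair:
  fixes a b :: real
  assumes "a < 1" "b < 1" "a + b \<le> 1"
  shows "a + b - 1 + (1 - a) * (1 - b) / (2 - a - b) \<le> a * b"
proof -
  have "(1 - a) * (1 - b) / (2 - a - b) \<le> (1 - a) * (1 - b)"
  proof -
    have "(1 - a) * (1 - b) * 1 \<le> (1 - a) * (1 - b) * (2 - a - b)"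
      using assms by (intro mult_left_mono) auto
    then show ?thesis using assms by (simp add: divide_le_eq)
  qed
  then show ?thesis by (simp add: algebra_simps)
qed

text \<open>The constant 9/8 is sharp: equality holds at \<open>a = b = 2/3\<close>.\<close>

lemma harmonic_bound:
  fixes a b :: real
  assumes "0 \<le> a" "a < 1" "0 \<le> b" "b < 1"
  shows "a + b - 1 + (1 - a) * (1 - b) / (2 - a - b) \<le> 9 / 8 * (a * b)"
proof (cases "a + b \<le> 1")
  case True
  then show ?thesis using harmonic_bound_light_pair[of a b] assms
    using mult_nonneg_nonneg[of a b] by linarith
next
  case False
  define s p where "s = 2 - a - b" and "p = (1 - a) * (1 - b)"
  have s: "0 < s" "s < 1" using False assms by (auto simp: s_def)
  have p: "0 \<le> p" using assms by (simp add: p_def)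
  have "s\<^sup>2 - 4 * p = (a - b)\<^sup>2" by (simp add: s_def p_def power2_eq_square algebra_simps)
  then have p4: "4 * p \<le> s\<^sup>2" by (metis diff_ge_0_iff_ge zero_le_power2)
  \<comment> \<open>The claim with denominators cleared. If the left factor is positive, the worst
    case is \<open>p = s\<^sup>2 / 4\<close>, where the gap is a multiple of
    \<open>(3 * s - 2)\<^sup>2\<close>.\<close>
  have "p * (8 - 9 * s) \<le> s * (1 - s)"
  proof (cases "8 - 9 * s \<le> 0")
    case True
    then have "p * (8 - 9 * s) \<le> 0" using p by (simp add: mult_nonneg_nonpos)
    moreover have "0 \<le> s * (1 - s)" using s by simp
    ultimately show ?thesis by linarith
  next
    case False
    then have "4 * p * (8 - 9 * s) \<le> s\<^sup>2 * (8 - 9 * s)" using p4 by (intro mult_right_mono) auto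
    moreover have "4 * (s * (1 - s)) - s\<^sup>2 * (8 - 9 * s) = s * (3 * s - 2)\<^sup>2"
      by (simp add: power2_eq_square algebra_simps)
    moreover have "s * (3 * s - 2)\<^sup>2 \<ge> 0" using s by simp
    ultimately show ?thesis by linarith
  qed
  then have "1 - s + p / s \<le> 9 / 8 * (1 - s + p)"
    using s by (simp add: field_simps)
  moreover have "1 - s + p = a * b" by (simp add: s_def p_def algebra_simps)
  ultimately show ?thesis by (simp add: s_def p_def)
qed

section \<open>Summing the edge excess for a projection matrix\<close>

locale idempotent_gram =
  fixes P :: "'v::finite \<Rightarrow> 'v \<Rightarrow> real"
  assumes sym: "P u v = P v u"
    and idem: "(\<Sum>v\<in>UNIV. (P u v)\<^sup>2) = P u u"
begin

lemma diag_nonneg: "0 \<le> P u u"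
  using idem[of u] by (metis sum_nonneg zero_le_power2)

lemma sum_offdiag: "(\<Sum>v\<in>-{u}. (P u v)\<^sup>2) = P u u * (1 - P u u)"
  using idem[of u] sum.remove[of UNIV u "\<lambda>v. (P u v)\<^sup>2"]
  by (simp add: Compl_eq_Diff_UNIV power2_eq_square algebra_simps)

lemma diag_le_1: "P u u \<le> 1"
proof -
  have "0 \<le> P u u * (1 - P u u)" using sum_offdiag[of u] by (metis sum_nonneg zero_le_power2)
  then show ?thesis using diag_nonneg[of u] by (auto simp: zero_le_mult_iff)
qed

lemma offdiag_zero:
  assumes "P u u = 1" "v \<noteq> u"
  shows "P u v = 0" "P v u = 0"
proof -
  have "(\<Sum>v\<in>-{u}. (P u v)\<^sup>2) = 0" using sum_offdiag[of u] assms by simp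
  then show "P u v = 0" using assms by (simp add: sum_nonneg_eq_0_iff)
  then show "P v u = 0" using sym by simp
qed

text \<open>The scalar bound enters as a hypothesis with a factor \<open>g\<close>, so that both
  \<open>g = 9/8\<close> and \<open>g = 1\<close> can be used.\<close>

lemma edge_excess_le:
  assumes g: "g \<ge> 1" and uv: "u \<noteq> v"
    and harm: "P u u < 1 \<Longrightarrow> P v v < 1 \<Longrightarrow>
      P u u + P v v - 1 + (1 - P u u) * (1 - P v v) / (2 - P u u - P v v) \<le> g * (P u u * P v v)"
  shows "P u u + P v v - 1 - 2 * P u v \<le>
    g * (P u u * P v v) + (P u v)\<^sup>2 / (1 - P u u) + (P u v)\<^sup>2 / (1 - P v v)"
proof (cases "P u u = 1 \<or> P v v = 1")
  case True
  \<comment> \<open>Here Young's inequality would divide by zero. The excess equals the product of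
    the diagonal entries, and both fractions are 0.\<close>
  then have "P u v = 0" using offdiag_zero uv by metis
  moreover have "P u u * P v v \<le> g * (P u u * P v v)"
    using mult_right_mono[OF g, of "P u u * P v v"] diag_nonneg by simp
  ultimately show ?thesis using True by auto
next
  case False
  then have "P u u < 1" "P v v < 1" using diag_le_1[of u] diag_le_1[of v] by auto
  then show ?thesis using edge_excess_young[of "P u u" "P v v" "P u v"] harm by linarith
qed

text \<open>The upper bounds for single pairs are nonnegative, so the sum may be extended from the
  edges to all ordered pairs of distinct vertices. The fractions then contribute at most the trace
  for each of the two orientations.\<close>

lemma sum_edge_excess_le:
  assumes g: "g \<ge> 1" and N: "\<And>u. u \<notin> N u"
    and harm: "\<And>u v. u \<noteq> v \<Longrightarrow> P u u < 1 \<Longrightarrow> P v v < 1 \<Longrightarrow>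
      P u u + P v v - 1 + (1 - P u u) * (1 - P v v) / (2 - P u u - P v v) \<le> g * (P u u * P v v)"
  shows "(\<Sum>u\<in>UNIV. \<Sum>v\<in>N u. P u u + P v v - 1 - 2 * P u v) \<le>
    g * ((\<Sum>u\<in>UNIV. P u u)\<^sup>2 - (\<Sum>u\<in>UNIV. (P u u)\<^sup>2)) + 2 * (\<Sum>u\<in>UNIV. P u u)"
proof -
  define f where "f = (\<lambda>u v. (P u v)\<^sup>2 / (1 - P u u))"
  define t where "t = (\<Sum>u\<in>UNIV. P u u)"
  have f0: "f u v \<ge> 0" for u v using diag_le_1[of u] by (simp add: f_def)
  \<comment> \<open>Equality if \<open>P u u < 1\<close>; if \<open>P u u = 1\<close>, the sum is 0
    because division by zero gives 0.\<close>
  have "(\<Sum>v\<in>-{u}. f u v) \<le> P u u" for u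
    using sum_offdiag[of u] diag_nonneg[of u] by (simp add: f_def sum_divide_distrib[symmetric])
  then have F: "(\<Sum>u\<in>UNIV. \<Sum>v\<in>-{u}. f u v) \<le> t" unfolding t_def by (intro sum_mono)
  have F': "(\<Sum>u\<in>UNIV. \<Sum>v\<in>-{u}. f v u) = (\<Sum>u\<in>UNIV. \<Sum>v\<in>-{u}. f u v)"
    using sum.swap_restrict[of UNIV UNIV f "\<lambda>u v. u \<noteq> v"]
    by (simp add: Compl_eq neq_commute)
  have "(\<Sum>v\<in>-{u}. P v v) = t - P u u" for u
    using sum.remove[of UNIV u "\<lambda>v. P v v"] by (simp add: t_def Compl_eq_Diff_UNIV)
  then have "(\<Sum>v\<in>-{u}. P u u * P v v) = P u u * t - (P u u)\<^sup>2" for u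
    by (simp add: sum_distrib_left[symmetric] power2_eq_square right_diff_distrib)
  then have Q: "(\<Sum>u\<in>UNIV. \<Sum>v\<in>-{u}. P u u * P v v) = t\<^sup>2 - (\<Sum>u\<in>UNIV. (P u u)\<^sup>2)"
    by (simp add: sum_subtractf sum_distrib_right[symmetric] t_def[symmetric] power2_eq_square[of t])
  have nonneg: "0 \<le> g * (P u u * P v v) + f u v + f v u" for u v
    using g f0 diag_nonneg by simp
  have "(\<Sum>u\<in>UNIV. \<Sum>v\<in>N u. P u u + P v v - 1 - 2 * P u v) \<le>
      (\<Sum>u\<in>UNIV. \<Sum>v\<in>N u. g * (P u u * P v v) + f u v + f v u)"
  proof (intro sum_mono)
    fix u v assume "v \<in> N u"
    then have "u \<noteq> v" using N by blast
    then show "P u u + P v v - 1 - 2 * P u v \<le> g * (P u u * P v v) + f u v + f v u"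
      using edge_excess_le[OF g _ harm] sym by (simp add: f_def)
  qed
  also have "\<dots> \<le> (\<Sum>u\<in>UNIV. \<Sum>v\<in>-{u}. g * (P u u * P v v) + f u v + f v u)"
    using N nonneg by (intro sum_mono sum_mono2) auto
  also have "\<dots> = g * (\<Sum>u\<in>UNIV. \<Sum>v\<in>-{u}. P u u * P v v)
      + (\<Sum>u\<in>UNIV. \<Sum>v\<in>-{u}. f u v) + (\<Sum>u\<in>UNIV. \<Sum>v\<in>-{u}. f v u)"
    by (simp add: sum.distrib sum_distrib_left)
  finally show ?thesis using F F' Q by (simp add: t_def)
qed

lemma sum_edge_excess_le_square:
  assumes trace: "(\<Sum>u\<in>UNIV. P u u) = real k" and k: "k \<ge> 2" and N: "\<And>u. u \<notin> N u"
  shows "(\<Sum>u\<in>UNIV. \<Sum>v\<in>N u. P u u + P v v - 1 - 2 * P u v) \<le> 2 * (real k)\<^sup>2"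
proof -
  define L where "L = (\<Sum>u\<in>UNIV. \<Sum>v\<in>N u. P u u + P v v - 1 - 2 * P u v)"
  define q where "q = (\<Sum>u\<in>UNIV. (P u u)\<^sup>2)"
  have q0: "q \<ge> 0" by (simp add: q_def sum_nonneg)
  have weak: "L \<le> 9 / 8 * ((real k)\<^sup>2 - q) + 2 * real k"
    unfolding L_def q_def trace[symmetric]
    by (rule sum_edge_excess_le[OF _ N]) (use harmonic_bound diag_nonneg in auto)
  have "L \<le> 2 * (real k)\<^sup>2"
  proof -
    consider "k \<ge> 3" | u v where "k = 2" "u \<noteq> v" "P u u + P v v > 1"
      | "k = 2" "\<And>u v. u \<noteq> v \<Longrightarrow> P u u + P v v \<le> 1"
      using k by fastforce
    then show ?thesis
    proof cases
      case 1
      \<comment> \<open>This suffices because \<open>9/8 + 2/3 < 2\<close>.\<close>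
      then have "3 * real k \<le> (real k)\<^sup>2" by (simp add: power2_eq_square)
      then have "9 / 8 * ((real k)\<^sup>2 - q) + 2 * real k \<le> 2 * (real k)\<^sup>2"
        using q0 zero_le_power2[of "real k"] by argo
      then show ?thesis using weak by (rule order_trans[rotated])
    next
      case (2 u v)
      have "(P u u)\<^sup>2 + (P v v)\<^sup>2 = (\<Sum>w\<in>{u, v}. (P w w)\<^sup>2)" using 2 by simp
      also have "\<dots> \<le> q" unfolding q_def by (rule sum_mono2) auto
      finally have "(P u u)\<^sup>2 + (P v v)\<^sup>2 \<le> q" .
      moreover have "(P u u + P v v)\<^sup>2 \<le> 2 * ((P u u)\<^sup>2 + (P v v)\<^sup>2)"
        using zero_le_power2[of "P u u - P v v"] by (simp add: power2_sum power2_diff)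
      moreover have "1 < (P u u + P v v)\<^sup>2" using 2(3) by (simp add: one_less_power)
      \<comment> \<open>The diagonal loss \<open>q > 1/2\<close> saves the case:
        \<open>9/8 * 7/2 + 4 = 127/16 < 8\<close>.\<close>
      ultimately have "1 < 2 * q" by argo
      moreover have "L \<le> 9 / 8 * (4 - q) + 4" using weak 2(1) by simp
      ultimately have "L \<le> 8" by argo
      then show ?thesis using 2(1) by simp
    next
      case 3
      have "L \<le> 1 * ((real k)\<^sup>2 - q) + 2 * real k"
        unfolding L_def q_def trace[symmetric]
        by (rule sum_edge_excess_le[OF _ N]) (use harmonic_bound_light_pair 3(2) in auto)
      then show ?thesis using q0 3(1) by simp
    qed
  qed
  then show ?thesis by (simp only: L_def)
qed

end

section \<open>The largest eigenvalue: stars of long edges\<close>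

text \<open>Let \<open>r\<close> be the squared mass away from the centre \<open>w\<close>. Each
  term is at most \<open>(x u)\<^sup>2 / r\<close>, the difference being a square after
  multiplication by \<open>r\<close>, and the squared mass on \<open>M\<close> is at most
  \<open>r\<close>.\<close>

lemma star_excess_le_1:
  fixes x :: "'v::finite \<Rightarrow> real"
  assumes unit: "(\<Sum>u\<in>UNIV. (x u)\<^sup>2) = 1" and w: "w \<notin> M"
  shows "(\<Sum>u\<in>M. (x u - x w)\<^sup>2 - 1) \<le> 1"
proof -
  define r where "r = 1 - (x w)\<^sup>2"
  have "(\<Sum>u\<in>insert w M. (x u)\<^sup>2) \<le> 1"
    unfolding unit[symmetric] by (rule sum_mono2) auto
  then have M: "(\<Sum>u\<in>M. (x u)\<^sup>2) \<le> r" using w by (simp add: r_def)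
  have r0: "r \<ge> 0" using M by (meson order_trans sum_nonneg zero_le_power2)
  show ?thesis
  proof (cases "r = 0")
    \<comment> \<open>All mass sits at \<open>w\<close>, so every term is
      \<open>1 - 1 = 0\<close>.\<close>
    case True
    then have "(\<Sum>u\<in>M. (x u)\<^sup>2) = 0" using M by (metis antisym sum_nonneg zero_le_power2)
    then have "x u = 0" if "u \<in> M" for u using that by (simp add: sum_nonneg_eq_0_iff)
    then have "(\<Sum>u\<in>M. (x u - x w)\<^sup>2 - 1) = (\<Sum>u\<in>M. 0)"
      using True by (intro sum.cong) (auto simp: r_def)
    then show ?thesis by simp
  next
    case False
    then have r: "r > 0" using r0 by simp
    have "(x u - x w)\<^sup>2 - 1 \<le> (x u)\<^sup>2 / r" for u
    proof -
      have "(x u)\<^sup>2 - r * ((x u - x w)\<^sup>2 - 1) = (x u * x w + r)\<^sup>2"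
        by (simp add: r_def power2_eq_square algebra_simps)
      then have "r * ((x u - x w)\<^sup>2 - 1) \<le> (x u)\<^sup>2" by (metis diff_ge_0_iff_ge zero_le_power2)
      then show ?thesis using r by (simp add: field_simps)
    qed
    then have "(\<Sum>u\<in>M. (x u - x w)\<^sup>2 - 1) \<le> (\<Sum>u\<in>M. (x u)\<^sup>2 / r)" by (rule sum_mono)
    also have "\<dots> = (\<Sum>u\<in>M. (x u)\<^sup>2) / r" by (simp add: sum_divide_distrib)
    also have "\<dots> \<le> 1" using M r by simp
    finally show ?thesis .
  qed
qed

text \<open>A long edge carries squared mass above 1/2, so two of them cannot be disjoint. Three
  values in [-1, 1] cannot be pairwise more than 1 apart, so there is no triangle. Pairwise
  intersecting edges without a triangle share a vertex.\<close>

lemma long_edges_form_star: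
  fixes x :: "'v::finite \<Rightarrow> real"
  assumes unit: "(\<Sum>u\<in>UNIV. (x u)\<^sup>2) = 1"
  obtains w where "\<And>u v. {u, v} \<in> E \<Longrightarrow> (x u - x v)\<^sup>2 > 1 \<Longrightarrow> u = w \<or> v = w"
proof -
  define F where "F u v \<longleftrightarrow> {u, v} \<in> E \<and> (x u - x v)\<^sup>2 > 1" for u v
  have F_sym: "F u v \<Longrightarrow> F v u" for u v by (simp add: F_def insert_commute power2_commute)
  have F_irrefl: "\<not> F u u" for u by (simp add: F_def)
  have bound: "\<bar>x u\<bar> \<le> 1" for u
  proof -
    have "(x u)\<^sup>2 \<le> (\<Sum>u\<in>UNIV. (x u)\<^sup>2)" by (rule member_le_sum) auto
    then show ?thesis using unit by (simp add: abs_square_le_1)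
  qed
  have far: "\<bar>x u - x v\<bar> > 1" if "F u v" for u v
    using that abs_square_le_1[of "x u - x v"] by (auto simp: F_def)
  have meet: "u = p \<or> u = q \<or> v = p \<or> v = q" if "F u v" "F p q" for u v p q
  proof (rule ccontr)
    assume "\<not> ?thesis"
    moreover have "u \<noteq> v" "p \<noteq> q" using that F_irrefl by auto
    ultimately have "(x u)\<^sup>2 + (x v)\<^sup>2 + (x p)\<^sup>2 + (x q)\<^sup>2 = (\<Sum>w\<in>{u, v, p, q}. (x w)\<^sup>2)"
      by simp
    also have "\<dots> \<le> 1" unfolding unit[symmetric] by (rule sum_mono2) auto
    finally have "2 * ((x u)\<^sup>2 + (x v)\<^sup>2) + 2 * ((x p)\<^sup>2 + (x q)\<^sup>2) \<le> 2" by simp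
    moreover have "1 < 2 * ((x i)\<^sup>2 + (x j)\<^sup>2)" if "F i j" for i j
      using that zero_le_power2[of "x i + x j"] by (simp add: F_def power2_sum power2_diff)
    then have "1 < 2 * ((x u)\<^sup>2 + (x v)\<^sup>2)" "1 < 2 * ((x p)\<^sup>2 + (x q)\<^sup>2)"
      using that by auto
    ultimately show False by linarith
  qed
  have no_triangle: False if "F u v" "F v w" "F u w" for u v w
    using far[OF that(1)] far[OF that(2)] far[OF that(3)] bound[of u] bound[of v] bound[of w]
    by linarith
  have "\<exists>w. \<forall>u v. F u v \<longrightarrow> u = w \<or> v = w"
  proof (rule ccontr)
    assume neg: "\<nexists>w. \<forall>u v. F u v \<longrightarrow> u = w \<or> v = w"
    then obtain u v where uv: "F u v" by blast
    \<comment> \<open>Since \<open>u\<close> is not a centre, some long edge avoids it and must meet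
      \<open>uv\<close> in \<open>v\<close>; likewise with the roles exchanged for
      \<open>t\<close>.\<close>
    obtain q where q: "F v q" "q \<noteq> u" using neg meet[OF uv] F_sym by metis
    obtain t where t: "F u t" "t \<noteq> v" using neg meet[OF uv] F_sym by metis
    have "q = t" using meet[OF q(1) t(1)] uv F_irrefl q t by auto
    then show False using no_triangle uv q t by blast
  qed
  then show thesis using that by (auto simp: F_def)
qed

text \<open>Only pairs of positive excess are kept. They form a star, seen once in each orientation,
  and each orientation contributes at most 1.\<close>

lemma sum_edge_excess_unit_vector:
  fixes x :: "'v::finite \<Rightarrow> real"
  assumes unit: "(\<Sum>u\<in>UNIV. (x u)\<^sup>2) = 1"
  shows "(\<Sum>u\<in>UNIV. \<Sum>v | {u, v} \<in> E. (x u - x v)\<^sup>2 - 1) \<le> 2"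
proof -
  obtain w where w: "\<And>u v. {u, v} \<in> E \<Longrightarrow> (x u - x v)\<^sup>2 > 1 \<Longrightarrow> u = w \<or> v = w"
    using long_edges_form_star[OF unit] by blast
  define M where "M = {u. {u, w} \<in> E \<and> (x u - x w)\<^sup>2 > 1}"
  have wM: "w \<notin> M" by (simp add: M_def)
  have star: "{(u, v). {u, v} \<in> E \<and> (x u - x v)\<^sup>2 > 1} = M \<times> {w} \<union> {w} \<times> M"
  proof -
    have "{u, v} \<in> E \<and> (x u - x v)\<^sup>2 > 1 \<longleftrightarrow> u \<in> M \<and> v = w \<or> u = w \<and> v \<in> M" for u v
      using w[of u v] by (auto simp: M_def insert_commute power2_commute)
    then show ?thesis by auto
  qed
  define h where "h = (\<lambda>(u, v). (x u - x v)\<^sup>2 - 1)"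
  have "(\<Sum>u\<in>UNIV. \<Sum>v | {u, v} \<in> E. (x u - x v)\<^sup>2 - 1) = sum h {(u, v). {u, v} \<in> E}"
    by (simp add: h_def sum.Sigma Sigma_def) (rule sum.cong, auto)
  also have "\<dots> \<le> sum h (M \<times> {w} \<union> {w} \<times> M)"
  proof -
    let ?D = "{(u, v). {u, v} \<in> E}"
    have "sum h ?D \<le> (\<Sum>p\<in>?D. if h p > 0 then h p else 0)" by (rule sum_mono) auto
    also have "\<dots> = sum h {p \<in> ?D. h p > 0}" by (rule sum.inter_filter[symmetric]) simp
    also have "{p \<in> ?D. h p > 0} = {(u, v). {u, v} \<in> E \<and> (x u - x v)\<^sup>2 > 1}"
      by (auto simp: h_def)
    also note star
    finally show ?thesis .
  qed
  also have "\<dots> = 2 * (\<Sum>u\<in>M. (x u - x w)\<^sup>2 - 1)"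
    using wM by (subst sum.union_disjoint)
      (auto simp: h_def sum.cartesian_product[symmetric] power2_commute)
  finally show ?thesis using star_excess_le_1[OF unit wM] by simp
qed

section \<open>The bound on the eigenvalue sum\<close>

theorem theorem1p8:
  fixes E :: "'v::finite set set" and k :: nat
  assumes "simple_graph E"
    and "k \<ge> 1"
    and "CARD('v) \<ge> k"
  shows "(\<Sum>i=1..k. eigval i (laplacian E)) \<le> real (card E) + (real k)\<^sup>2"
proof -
  obtain S :: "(real^'v) set" where S: "finite S" "card S = k" "pairwise orthogonal S"
    "\<And>x. x \<in> S \<Longrightarrow> norm x = 1"
    "(\<Sum>i=1..k. eigval i (laplacian E)) = (\<Sum>x\<in>S. x \<bullet> (laplacian E *v x))"
    using sum_eigval_eq[OF transpose_laplacian assms(3)] by blast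
  define P where "P = (\<lambda>u v. \<Sum>x\<in>S. x $ u * x $ v)"
  have gram: "idempotent_gram P"
    by unfold_locales
      (simp_all add: P_def mult.commute orthonormal_gram_idempotent[OF S(1,3,4)])
  have trace: "(\<Sum>u\<in>UNIV. P u u) = real k"
    using orthonormal_gram_trace[OF S(4)] S(2) by (simp add: P_def)
  have "(\<Sum>u\<in>UNIV. \<Sum>v | {u, v} \<in> E. P u u + P v v - 1 - 2 * P u v) \<le> 2 * (real k)\<^sup>2"
  proof (cases "k = 1")
    case True
    then obtain x where x: "S = {x}" using S(2) card_1_singletonE by metis
    have "(\<Sum>u\<in>UNIV. (x $ u)\<^sup>2) = 1" using trace True by (simp add: P_def x power2_eq_square)
    \<comment> \<open>For a single vector the excess is
      \<open>(x $ u - x $ v)\<^sup>2 - 1\<close>.\<close>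
    from sum_edge_excess_unit_vector[OF this, of E] show ?thesis
      by (simp add: P_def x True power2_diff power2_eq_square algebra_simps)
  next
    case False
    then show ?thesis
      using assms
      by (intro idempotent_gram.sum_edge_excess_le_square[OF gram trace]) (auto simp: simple_graph_def)
  qed
  then show ?thesis
    using sum_laplacian_quadratic_forms[OF assms(1), of S] S(5) by (simp add: P_def)
qed

end
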